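(* Let $(L;\wedge,\vee,^{\Delta},^{\nabla},0,1)$ be a weakly dicomplemented lattice. For $F$ a filter of $L$ let $F^{\star}=\{a\in L\mid x^{\Delta}\le a\ \forall x\in F\}$, let $F_p(L)=\{[a)\mid a\in L\}$ be the set of principal filters $[a)=\{x\in L\mid a\le x\}$, and let $\Lambda(L)=\{[a)^{\star}\mid a\in L\}$. (1) $(F_p(L);\cap,\vee,^{\star},\{1\},L)$ (with $\vee$ the join of filters) is a dual weakly complemented lattice, and it is dually isomorphic to the weakly complemented lattice $(L;\vee,\wedge,^{\Delta},0,1)$ via $a\mapsto[a)$; that is, this map is a bijection with $[a\vee b)=[a)\cap[b)$, $[a\wedge b)=[a)\vee[b)$ and $[a^{\Delta})=[a)^{\star}$. (2) $\Lambda(L)$, ordered by inclusion, with meet $\cap$, join the join in the poset $(\Lambda(L),\subseteq)$, and unary operation $^{\star}$, is an ortholattice with least element $\{1\}$ and greatest element $L$, and it is isomorphic (as an ortholattice) to $(\overline{S}(L);\overline{\sqcap},\vee,^{\Delta},0,1)$.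
   Context: A weakly dicomplemented lattice (WDL) is an algebra $(L;\wedge,\vee,^{\Delta},^{\nabla},0,1)$ such that $(L;\wedge,\vee,0,1)$ is a bounded lattice and, for all $x,y\in L$: $x^{\Delta\Delta}\le x$; $x\le y\Rightarrow y^{\Delta}\le x^{\Delta}$; $(x\wedge y)\vee(x\wedge y^{\Delta})=x$; $x^{\nabla\nabla}\ge x$; $x\le y\Rightarrow y^{\nabla}\le x^{\nabla}$; $(x\vee y)\wedge(x\vee y^{\nabla})=x$. A weakly complemented lattice is a bounded lattice with a unary operation satisfying the first three axioms; a dual weakly complemented lattice is a bounded lattice with a unary operation satisfying the last three. A filter is a nonempty upward closed subset closed under $\wedge$. $\overline{S}(L)=\{x\in L\mid x^{\Delta\Delta}=x\}$ and $x\,\overline{\sqcap}\,y=(x^{\Delta}\vee y^{\Delta})^{\Delta}$. An ortholattice is a bounded lattice with a unary operation $^{\perp}$ that is order-reversing, involutive ($a^{\perp\perp}=a$), and satisfies $a\vee a^{\perp}=1$, $a\wedge a^{\perp}=0$. *)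

theory Defs
  imports "HOL-Algebra.Lattice"
begin

text \<open>
  Bounded lattices are the carrier-based ones of \<^theory>\<open>HOL-Algebra.Lattice\<close>: the
  operations \<open>\<sqinter>\<close>, \<open>\<squnion>\<close>, \<open>\<bottom>\<close>, \<open>\<top>\<close> of such a structure are determined by its carrier and order.
  Whenever the mathematics prescribes concrete operations on a carrier (for instance \<open>\<inter>\<close>),
  the claim is that they coincide on that carrier with the ones determined by the order.
\<close>

locale weakly_complemented_lattice = bounded_lattice L for L (structure) +
  fixes delta :: "'a \<Rightarrow> 'a"
  assumes delta_closed: "x \<in> carrier L \<Longrightarrow> delta x \<in> carrier L"
    and delta_delta_le: "x \<in> carrier L \<Longrightarrow> delta (delta x) \<sqsubseteq> x"
    and delta_antitone:
      "\<lbrakk>x \<in> carrier L; y \<in> carrier L; x \<sqsubseteq> y\<rbrakk> \<Longrightarrow> delta y \<sqsubseteq> delta x"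
    and delta_split:
      "\<lbrakk>x \<in> carrier L; y \<in> carrier L\<rbrakk> \<Longrightarrow> (x \<sqinter> y) \<squnion> (x \<sqinter> delta y) = x"

locale dual_weakly_complemented_lattice = bounded_lattice L for L (structure) +
  fixes nabla :: "'a \<Rightarrow> 'a"
  assumes nabla_closed: "x \<in> carrier L \<Longrightarrow> nabla x \<in> carrier L"
    and le_nabla_nabla: "x \<in> carrier L \<Longrightarrow> x \<sqsubseteq> nabla (nabla x)"
    and nabla_antitone:
      "\<lbrakk>x \<in> carrier L; y \<in> carrier L; x \<sqsubseteq> y\<rbrakk> \<Longrightarrow> nabla y \<sqsubseteq> nabla x"
    and nabla_split:
      "\<lbrakk>x \<in> carrier L; y \<in> carrier L\<rbrakk> \<Longrightarrow> (x \<squnion> y) \<sqinter> (x \<squnion> nabla y) = x"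

locale weakly_dicomplemented_lattice =
  weakly_complemented_lattice L delta + dual_weakly_complemented_lattice L nabla
  for L (structure) and delta and nabla

locale ortholattice = bounded_lattice L for L (structure) +
  fixes perp :: "'a \<Rightarrow> 'a"
  assumes perp_closed: "a \<in> carrier L \<Longrightarrow> perp a \<in> carrier L"
    and perp_antitone:
      "\<lbrakk>a \<in> carrier L; b \<in> carrier L; a \<sqsubseteq> b\<rbrakk> \<Longrightarrow> perp b \<sqsubseteq> perp a"
    and perp_perp: "a \<in> carrier L \<Longrightarrow> perp (perp a) = a"
    and join_perp: "a \<in> carrier L \<Longrightarrow> a \<squnion> perp a = \<top>"
    and meet_perp: "a \<in> carrier L \<Longrightarrow> a \<sqinter> perp a = \<bottom>"

definition ortholattice_iso ::
    "('a, 'c) gorder_scheme \<Rightarrow> ('a \<Rightarrow> 'a) \<Rightarrow> ('b, 'd) gorder_scheme \<Rightarrow> ('b \<Rightarrow> 'b) \<Rightarrow> ('a \<Rightarrow> 'b) \<Rightarrow> bool"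
  where "ortholattice_iso P p Q q f \<longleftrightarrow>
    ortholattice P p \<and> ortholattice Q q \<and>
    bij_betw f (carrier P) (carrier Q) \<and>
    (\<forall>x\<in>carrier P. \<forall>y\<in>carrier P. f (x \<sqinter>\<^bsub>P\<^esub> y) = f x \<sqinter>\<^bsub>Q\<^esub> f y) \<and>
    (\<forall>x\<in>carrier P. \<forall>y\<in>carrier P. f (x \<squnion>\<^bsub>P\<^esub> y) = f x \<squnion>\<^bsub>Q\<^esub> f y) \<and>
    (\<forall>x\<in>carrier P. f (p x) = q (f x)) \<and>
    f \<bottom>\<^bsub>P\<^esub> = \<bottom>\<^bsub>Q\<^esub> \<and> f \<top>\<^bsub>P\<^esub> = \<top>\<^bsub>Q\<^esub>"

definition lattice_filter :: "('a, 'b) gorder_scheme \<Rightarrow> 'a set \<Rightarrow> bool"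
  where "lattice_filter L F \<longleftrightarrow>
    F \<subseteq> carrier L \<and> F \<noteq> {} \<and>
    (\<forall>x\<in>F. \<forall>y\<in>carrier L. x \<sqsubseteq>\<^bsub>L\<^esub> y \<longrightarrow> y \<in> F) \<and>
    (\<forall>x\<in>F. \<forall>y\<in>F. x \<sqinter>\<^bsub>L\<^esub> y \<in> F)"

definition inclusion_order :: "'a set set \<Rightarrow> 'a set gorder"
  where "inclusion_order C = \<lparr>carrier = C, eq = (=), le = (\<subseteq>)\<rparr>"

definition filter_join :: "('a, 'b) gorder_scheme \<Rightarrow> 'a set \<Rightarrow> 'a set \<Rightarrow> 'a set"
  where "filter_join L F G = F \<squnion>\<^bsub>inclusion_order {H. lattice_filter L H}\<^esub> G"

definition principal_filter :: "('a, 'b) gorder_scheme \<Rightarrow> 'a \<Rightarrow> 'a set"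
  where "principal_filter L a = {x \<in> carrier L. a \<sqsubseteq>\<^bsub>L\<^esub> x}"

definition filter_star :: "('a, 'b) gorder_scheme \<Rightarrow> ('a \<Rightarrow> 'a) \<Rightarrow> 'a set \<Rightarrow> 'a set"
  where "filter_star L delta F = {a \<in> carrier L. \<forall>x\<in>F. delta x \<sqsubseteq>\<^bsub>L\<^esub> a}"

definition principal_filters :: "('a, 'b) gorder_scheme \<Rightarrow> 'a set set"
  where "principal_filters L = principal_filter L ` carrier L"

definition star_principal_filters :: "('a, 'b) gorder_scheme \<Rightarrow> ('a \<Rightarrow> 'a) \<Rightarrow> 'a set set"
  where "star_principal_filters L delta =
    (\<lambda>a. filter_star L delta (principal_filter L a)) ` carrier L"

definition dual_skeleton :: "('a, 'b) gorder_scheme \<Rightarrow> ('a \<Rightarrow> 'a) \<Rightarrow> 'a set"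
  where "dual_skeleton L delta = {x \<in> carrier L. delta (delta x) = x}"

definition dual_skeleton_meet ::
    "('a, 'b) gorder_scheme \<Rightarrow> ('a \<Rightarrow> 'a) \<Rightarrow> 'a \<Rightarrow> 'a \<Rightarrow> 'a"
  where "dual_skeleton_meet L delta x y = delta (delta x \<squnion>\<^bsub>L\<^esub> delta y)"

end

theory Submission
  imports Defs
begin

text \<open>
  The map \<open>a \<mapsto> [a)\<close> is an order anti-isomorphism of \<open>L\<close> onto its principal filters and takes \<open>\<^sup>\<Delta>\<close>
  to \<open>\<^sup>\<star>\<close>, so part (1) is the dual of the structure on \<open>L\<close>. For part (2), the fixed points of
  \<open>\<^sup>\<Delta>\<^sup>\<Delta>\<close> are exactly the elements \<open>a\<^sup>\<Delta>\<close>; on them \<open>\<^sup>\<Delta>\<close> is an order-reversing involution, and composing it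
  with \<open>a \<mapsto> [a)\<close> gives an order isomorphism of the dual skeleton onto \<open>\<Lambda>(L)\<close>.
\<close>

section \<open>Lattice operations and order isomorphisms\<close>

context partial_order
begin

text \<open>\<open>\<squnion>\<close> is a choice among least upper bounds, and antisymmetry leaves
  only one candidate. The \<open>least\<close> conclusion later proves that joins exist; the
  equation computes them. No lattice structure is presupposed, so the rule applies to bare posets;
  meets and bounds follow the same pattern.\<close>

lemma join_eqI:
  assumes "x \<in> carrier L" "y \<in> carrier L" "s \<in> carrier L" "x \<sqsubseteq> s" "y \<sqsubseteq> s"
    and "\<And>z. \<lbrakk>z \<in> carrier L; x \<sqsubseteq> z; y \<sqsubseteq> z\<rbrakk> \<Longrightarrow> s \<sqsubseteq> z"
  shows "least L s (Upper L {x, y})" "x \<squnion> y = s"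
proof -
  show *: "least L s (Upper L {x, y})"
    by (rule least_UpperI) (use assms in \<open>auto simp: Upper_def\<close>)
  show "x \<squnion> y = s"
    unfolding join_def sup_def by (rule some_equality[of _ s]) (auto intro: * least_unique)
qed

lemma meet_eqI:
  assumes "x \<in> carrier L" "y \<in> carrier L" "i \<in> carrier L" "i \<sqsubseteq> x" "i \<sqsubseteq> y"
    and "\<And>z. \<lbrakk>z \<in> carrier L; z \<sqsubseteq> x; z \<sqsubseteq> y\<rbrakk> \<Longrightarrow> z \<sqsubseteq> i"
  shows "greatest L i (Lower L {x, y})" "x \<sqinter> y = i"
proof -
  show *: "greatest L i (Lower L {x, y})"
    by (rule greatest_LowerI) (use assms in \<open>auto simp: Lower_def\<close>)
  show "x \<sqinter> y = i"
    unfolding meet_def inf_def by (rule some_equality[of _ i]) (auto intro: * greatest_unique)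
qed

lemma bottom_eqI:
  assumes "b \<in> carrier L" "\<And>x. x \<in> carrier L \<Longrightarrow> b \<sqsubseteq> x"
  shows "least L b (carrier L)" "\<bottom> = b"
proof -
  show *: "least L b (carrier L)"
    using assms by (auto simp: least_def)
  show "\<bottom> = b"
    unfolding bottom_def by (rule some_equality[of _ b]) (auto intro: * least_unique)
qed

lemma top_eqI:
  assumes "t \<in> carrier L" "\<And>x. x \<in> carrier L \<Longrightarrow> x \<sqsubseteq> t"
  shows "greatest L t (carrier L)" "\<top> = t"
proof -
  show *: "greatest L t (carrier L)"
    using assms by (auto simp: greatest_def)
  show "\<top> = t"
    unfolding top_def by (rule some_equality[of _ t]) (auto intro: * greatest_unique)
qed

end

lemma partial_order_subset:
  assumes "partial_order L" "A \<subseteq> carrier L"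
  shows "partial_order (L\<lparr>carrier := A\<rparr>)"
proof -
  interpret partial_order L by fact
  interpret A: weak_partial_order "L\<lparr>carrier := A\<rparr>"
    by (rule weak_partial_order_subset) (use assms weak_partial_order_axioms in auto)
  show ?thesis
    by unfold_locales (simp add: eq_is_equal)
qed

text \<open>Passing to \<open>inv_gorder L\<close> turns the order-reversing map a \<mapsto> [a)
  into an order-preserving one, so a single notion of order isomorphism serves both claims.\<close>

lemma (in bounded_lattice) dual_bounded_lattice: "bounded_lattice (inv_gorder L)"
proof -
  interpret dual: lattice "inv_gorder L" by (rule dual_lattice)
  show ?thesis
    by unfold_locales (use top_exists bottom_exists in auto)
qed

text \<open>\<open>Q\<close> is assumed to be only a poset: in both applications it is a family of
  sets under inclusion, whose lattice operations are found by transport from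
  \<open>P\<close>.\<close>

locale bounded_lattice_order_iso = P: bounded_lattice P + Q: partial_order Q
  for P :: "('a, 'c) gorder_scheme" and Q :: "('b, 'd) gorder_scheme" +
  fixes f :: "'a \<Rightarrow> 'b"
  assumes bij: "bij_betw f (carrier P) (carrier Q)"
    and le_iff: "\<lbrakk>x \<in> carrier P; y \<in> carrier P\<rbrakk> \<Longrightarrow> f x \<sqsubseteq>\<^bsub>Q\<^esub> f y \<longleftrightarrow> x \<sqsubseteq>\<^bsub>P\<^esub> y"
begin

lemma image_closed: "x \<in> carrier P \<Longrightarrow> f x \<in> carrier Q"
  using bij by (auto simp: bij_betw_def)

lemma preimage:
  assumes "y \<in> carrier Q"
  obtains x where "x \<in> carrier P" "y = f x"
  using assms bij by (auto simp: bij_betw_def)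

text \<open>Surjectivity makes each upper bound of f x and f y the image of some z, and
  \<open>le_iff\<close> makes z an upper bound of x and y.\<close>

lemma join_image:
  assumes "x \<in> carrier P" "y \<in> carrier P"
  shows "least Q (f (x \<squnion>\<^bsub>P\<^esub> y)) (Upper Q {f x, f y})" "f x \<squnion>\<^bsub>Q\<^esub> f y = f (x \<squnion>\<^bsub>P\<^esub> y)"
  using assms by (auto intro!: Q.join_eqI elim!: preimage
      simp: image_closed le_iff P.join_left P.join_right P.join_le)

lemma meet_image:
  assumes "x \<in> carrier P" "y \<in> carrier P"
  shows "greatest Q (f (x \<sqinter>\<^bsub>P\<^esub> y)) (Lower Q {f x, f y})" "f x \<sqinter>\<^bsub>Q\<^esub> f y = f (x \<sqinter>\<^bsub>P\<^esub> y)"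
  using assms by (auto intro!: Q.meet_eqI elim!: preimage
      simp: image_closed le_iff P.meet_left P.meet_right P.meet_le)

lemma bottom_image: "least Q (f \<bottom>\<^bsub>P\<^esub>) (carrier Q)" "\<bottom>\<^bsub>Q\<^esub> = f \<bottom>\<^bsub>P\<^esub>"
  by (auto intro!: Q.bottom_eqI elim!: preimage simp: image_closed le_iff)

lemma top_image: "greatest Q (f \<top>\<^bsub>P\<^esub>) (carrier Q)" "\<top>\<^bsub>Q\<^esub> = f \<top>\<^bsub>P\<^esub>"
  by (auto intro!: Q.top_eqI elim!: preimage simp: image_closed le_iff)

lemma bounded_lattice_image: "bounded_lattice Q"
  by unfold_locales (auto elim!: preimage intro: join_image(1) meet_image(1) bottom_image(1) top_image(1))

text \<open>By surjectivity, \<open>comm\<close> determines \<open>q\<close> on all of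
  \<open>carrier Q\<close>, so each ortholattice law for \<open>q\<close> is the image of the same
  law for \<open>p\<close>.\<close>

lemma ortholattice_iso_image:
  assumes "ortholattice P p" and comm: "\<And>x. x \<in> carrier P \<Longrightarrow> f (p x) = q (f x)"
  shows "ortholattice_iso P p Q q f"
proof -
  interpret P: ortholattice P p by fact
  interpret Q: bounded_lattice Q by (rule bounded_lattice_image)
  have "ortholattice Q q"
  proof
    fix a assume "a \<in> carrier Q"
    then obtain x where x: "x \<in> carrier P" "a = f x" by (rule preimage)
    note [simp] = x comm[symmetric] image_closed P.perp_closed
    show "q a \<in> carrier Q" by simp
    show "q (q a) = a" by (simp add: P.perp_perp)
    show "a \<squnion>\<^bsub>Q\<^esub> q a = \<top>\<^bsub>Q\<^esub>" by (simp add: join_image top_image P.join_perp)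
    show "a \<sqinter>\<^bsub>Q\<^esub> q a = \<bottom>\<^bsub>Q\<^esub>" by (simp add: meet_image bottom_image P.meet_perp)
    fix b assume "b \<in> carrier Q" and le: "a \<sqsubseteq>\<^bsub>Q\<^esub> b"
    then obtain y where y: "y \<in> carrier P" "b = f y" by (auto elim: preimage)
    with le show "q b \<sqsubseteq>\<^bsub>Q\<^esub> q a" by (simp add: le_iff P.perp_antitone)
  qed
  then show ?thesis
    unfolding ortholattice_iso_def
    using assms bij by (simp add: join_image meet_image bottom_image top_image)
qed

end

text \<open>The isomorphism is built from the dual skeleton to \<Lambda>(L), while the claim asks
  for the other direction. Every element of \<open>Q\<close> has the form f x, so the laws for the
  inverse reduce to \<open>gf\<close>.\<close>

lemma ortholattice_iso_sym:
  assumes "ortholattice_iso P p Q q f"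
  shows "ortholattice_iso Q q P p (the_inv_into (carrier P) f)"
proof -
  let ?g = "the_inv_into (carrier P) f"
  interpret P: ortholattice P p using assms by (simp add: ortholattice_iso_def)
  have bij: "bij_betw f (carrier P) (carrier Q)"
    using assms by (simp add: ortholattice_iso_def)
  have gf [simp]: "?g (f x) = x" if "x \<in> carrier P" for x
    using bij that by (simp add: bij_betw_def the_inv_into_f_f)
  have Q: "carrier Q = f ` carrier P"
    using bij by (simp add: bij_betw_def)
  have "?g (f x \<squnion>\<^bsub>Q\<^esub> f y) = x \<squnion>\<^bsub>P\<^esub> y" "?g (f x \<sqinter>\<^bsub>Q\<^esub> f y) = x \<sqinter>\<^bsub>P\<^esub> y"
    if "x \<in> carrier P" "y \<in> carrier P" for x y
    using assms that gf[of "x \<squnion>\<^bsub>P\<^esub> y"] gf[of "x \<sqinter>\<^bsub>P\<^esub> y"] by (simp_all add: ortholattice_iso_def)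
  moreover have "?g (q (f x)) = p x" if "x \<in> carrier P" for x
    using assms that gf[of "p x"] P.perp_closed by (simp add: ortholattice_iso_def)
  moreover have "?g \<bottom>\<^bsub>Q\<^esub> = \<bottom>\<^bsub>P\<^esub>" "?g \<top>\<^bsub>Q\<^esub> = \<top>\<^bsub>P\<^esub>"
    using assms gf[of "\<bottom>\<^bsub>P\<^esub>"] gf[of "\<top>\<^bsub>P\<^esub>"] by (simp_all add: ortholattice_iso_def)
  ultimately show ?thesis
    using assms bij_betw_the_inv_into[OF bij] by (simp add: ortholattice_iso_def Q)
qed

section \<open>Principal filters\<close>

lemma inclusion_order_simps [simp]:
  "carrier (inclusion_order C) = C"
  "F \<sqsubseteq>\<^bsub>inclusion_order C\<^esub> G \<longleftrightarrow> F \<subseteq> G"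
  by (simp_all add: inclusion_order_def)

lemma partial_order_inclusion_order: "partial_order (inclusion_order C)"
  by unfold_locales (auto simp: inclusion_order_def)

text \<open>Since a lies in [a), inclusion in [b) already forces b \<sqsubseteq> a; the converse is
  transitivity.\<close>

lemma (in weak_partial_order) principal_filter_subset_iff:
  assumes "a \<in> carrier L" "b \<in> carrier L"
  shows "principal_filter L a \<subseteq> principal_filter L b \<longleftrightarrow> b \<sqsubseteq> a"
  using assms by (auto simp: principal_filter_def intro: le_trans)

lemma (in partial_order) inj_on_principal_filter: "inj_on (principal_filter L) (carrier L)"
  by (rule inj_onI) (metis principal_filter_subset_iff le_antisym order_refl)

lemma (in weak_upper_semilattice) principal_filter_join:
  assumes "a \<in> carrier L" "b \<in> carrier L"
  shows "principal_filter L (a \<squnion> b) = principal_filter L a \<inter> principal_filter L b"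
  using assms by (auto simp: principal_filter_def join_le
      intro: le_trans[OF join_left] le_trans[OF join_right])

lemma (in weak_lower_semilattice) lattice_filter_principal_filter:
  assumes "a \<in> carrier L"
  shows "lattice_filter L (principal_filter L a)"
  using assms by (auto simp: lattice_filter_def principal_filter_def meet_le intro: le_trans)

text \<open>The join is taken among all filters, so [a \<sqinter> b) is compared with an arbitrary
  filter \<open>H\<close> containing a and b: closure under meets gives a \<sqinter> b in
  \<open>H\<close>, and upward closure gives the rest.\<close>

lemma (in weak_lower_semilattice) principal_filter_meet:
  assumes a: "a \<in> carrier L" and b: "b \<in> carrier L"
  shows "principal_filter L (a \<sqinter> b) = filter_join L (principal_filter L a) (principal_filter L b)"
  unfolding filter_join_def
proof (rule HOL.sym, rule partial_order.join_eqI(2)[OF partial_order_inclusion_order])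
  fix H
  assume "H \<in> carrier (inclusion_order {H. lattice_filter L H})"
    and "principal_filter L a \<sqsubseteq>\<^bsub>inclusion_order {H. lattice_filter L H}\<^esub> H"
    and "principal_filter L b \<sqsubseteq>\<^bsub>inclusion_order {H. lattice_filter L H}\<^esub> H"
  then have H: "lattice_filter L H" "a \<in> H" "b \<in> H"
    using a b by (auto simp: principal_filter_def)
  then have "a \<sqinter> b \<in> H" by (simp add: lattice_filter_def)
  then show "principal_filter L (a \<sqinter> b) \<sqsubseteq>\<^bsub>inclusion_order {H. lattice_filter L H}\<^esub> H"
    using H by (auto simp: lattice_filter_def principal_filter_def)
qed (use a b in \<open>auto simp: lattice_filter_principal_filter principal_filter_subset_iff
      meet_left meet_right\<close>)

lemma (in bounded_lattice) principal_filter_bottom: "principal_filter L \<bottom> = carrier L"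
  by (auto simp: principal_filter_def)

lemma (in bounded_lattice) principal_filter_top: "principal_filter L \<top> = {\<top>}"
  by (auto simp: principal_filter_def intro: top_eq le_antisym)

lemma (in bounded_lattice) bounded_lattice_order_iso_principal_filter:
  "bounded_lattice_order_iso (inv_gorder L) (inclusion_order (principal_filters L))
     (principal_filter L)"
proof -
  interpret dual: bounded_lattice "inv_gorder L" by (rule dual_bounded_lattice)
  interpret F: partial_order "inclusion_order (principal_filters L)"
    by (rule partial_order_inclusion_order)
  show ?thesis
    by unfold_locales
      (auto simp: bij_betw_def inj_on_principal_filter principal_filters_def principal_filter_subset_iff)
qed

section \<open>Weakly complemented lattices\<close>

context weakly_complemented_lattice
begin

text \<open>For x in [a), antitonicity gives \<open>delta x\<close> \<sqsubseteq>
  \<open>delta a\<close>, with equality at x = a. So \<open>delta a\<close> is the greatest of the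
  elements \<open>delta x\<close>, and bounding all of them from above means bounding it.\<close>

lemma principal_filter_delta:
  assumes "a \<in> carrier L"
  shows "principal_filter L (delta a) = filter_star L delta (principal_filter L a)"
  using assms by (auto simp: principal_filter_def filter_star_def
      intro: le_trans[OF delta_antitone] delta_closed)

lemma dual_weakly_complemented_lattice_principal_filters:
  "dual_weakly_complemented_lattice (inclusion_order (principal_filters L)) (filter_star L delta)"
proof -
  let ?F = "inclusion_order (principal_filters L)"
  interpret iso: bounded_lattice_order_iso "inv_gorder L" ?F "principal_filter L"
    by (rule bounded_lattice_order_iso_principal_filter)
  interpret F: bounded_lattice ?F by (rule iso.bounded_lattice_image)
  note [simp] = principal_filter_delta[symmetric] delta_closed
  show ?thesis
  proof
    fix F assume "F \<in> carrier ?F"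
    then obtain a where a: "a \<in> carrier L" "F = principal_filter L a"
      by (auto simp: principal_filters_def)
    show "filter_star L delta F \<in> carrier ?F"
      using a by (simp add: principal_filters_def)
    show "F \<sqsubseteq>\<^bsub>?F\<^esub> filter_star L delta (filter_star L delta F)"
      using a by (simp add: principal_filter_subset_iff delta_delta_le)
    fix G assume "G \<in> carrier ?F"
    then obtain b where b: "b \<in> carrier L" "G = principal_filter L b"
      by (auto simp: principal_filters_def)
    show "filter_star L delta G \<sqsubseteq>\<^bsub>?F\<^esub> filter_star L delta F" if "F \<sqsubseteq>\<^bsub>?F\<^esub> G"
      using a b that by (simp add: principal_filter_subset_iff delta_antitone)
    \<comment> \<open>Joins of principal filters are images of meets in \<open>L\<close>, and meets
      are images of joins, so this law is the image of \<open>delta_split\<close>.\<close>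
    show "(F \<squnion>\<^bsub>?F\<^esub> G) \<sqinter>\<^bsub>?F\<^esub> (F \<squnion>\<^bsub>?F\<^esub> filter_star L delta G) = F"
      using a b iso.join_image(2) iso.meet_image(2) by (simp add: delta_split)
  qed
qed

section \<open>The dual skeleton and its ortholattice structure\<close>

lemma delta_delta_delta:
  assumes "x \<in> carrier L"
  shows "delta (delta (delta x)) = delta x"
  \<comment> \<open>One inequality is \<open>delta_delta_le\<close> at \<open>delta x\<close>; the
    other applies antitonicity to \<open>delta (delta x)\<close> \<sqsubseteq> x.\<close>
  using assms by (auto intro!: le_antisym delta_antitone delta_delta_le delta_closed)

lemma delta_mem_dual_skeleton: "x \<in> carrier L \<Longrightarrow> delta x \<in> dual_skeleton L delta"
  by (simp add: dual_skeleton_def delta_closed delta_delta_delta)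

text \<open>Split \<top> along \<bottom>: the part \<top> \<sqinter> \<bottom> vanishes, so
  \<open>delta \<bottom>\<close> alone must make up \<top>.\<close>

lemma delta_bottom: "delta \<bottom> = \<top>"
proof -
  have "delta \<bottom> = \<top> \<sqinter> delta \<bottom>"
    using top_meet[of "delta \<bottom>"] by (simp add: eq_is_equal delta_closed)
  also have "\<dots> = (\<top> \<sqinter> \<bottom>) \<squnion> (\<top> \<sqinter> delta \<bottom>)"
    using top_meet[of \<bottom>] bottom_join[of "\<top> \<sqinter> delta \<bottom>"] by (simp add: eq_is_equal delta_closed)
  also have "\<dots> = \<top>" by (simp add: delta_split)
  finally show ?thesis .
qed

lemma bottom_mem_dual_skeleton: "\<bottom> \<in> dual_skeleton L delta"
  by (auto simp: dual_skeleton_def delta_closed intro!: le_antisym delta_delta_le)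

lemma top_mem_dual_skeleton: "\<top> \<in> dual_skeleton L delta"
  using delta_mem_dual_skeleton[of \<bottom>] by (simp add: delta_bottom)

lemma delta_top: "delta \<top> = \<bottom>"
  using bottom_mem_dual_skeleton by (simp add: dual_skeleton_def delta_bottom)

lemma join_delta:
  assumes "x \<in> carrier L"
  shows "x \<squnion> delta x = \<top>"
  using delta_split[of \<top> x] top_meet assms by (simp add: eq_is_equal delta_closed)

text \<open>Applying \<open>delta\<close> twice is monotone, so the double image of x \<squnion> y
  lies above x and y, which are fixed points; \<open>delta_delta_le\<close> gives the reverse
  inequality. Hence joins in the skeleton are those of \<open>L\<close>.\<close>

lemma join_mem_dual_skeleton:
  assumes "x \<in> dual_skeleton L delta" "y \<in> dual_skeleton L delta"
  shows "x \<squnion> y \<in> dual_skeleton L delta"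
proof -
  have xy: "x \<in> carrier L" "y \<in> carrier L" "delta (delta x) = x" "delta (delta y) = y"
    using assms by (auto simp: dual_skeleton_def)
  have "delta (delta x) \<sqsubseteq> delta (delta (x \<squnion> y))" "delta (delta y) \<sqsubseteq> delta (delta (x \<squnion> y))"
    using xy(1,2) by (auto intro!: delta_antitone simp: delta_closed join_left join_right)
  then have "x \<squnion> y \<sqsubseteq> delta (delta (x \<squnion> y))"
    using xy by (simp add: join_le delta_closed)
  then show ?thesis
    using xy(1,2) by (auto simp: dual_skeleton_def delta_closed intro!: le_antisym delta_delta_le)
qed

lemma partial_order_dual_skeleton: "partial_order (L\<lparr>carrier := dual_skeleton L delta\<rparr>)"
  by (rule partial_order_subset) (auto simp: dual_skeleton_def partial_order_axioms)

lemma dual_skeleton_join: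
  assumes "x \<in> dual_skeleton L delta" "y \<in> dual_skeleton L delta"
  defines "S \<equiv> L\<lparr>carrier := dual_skeleton L delta\<rparr>"
  shows "least S (x \<squnion> y) (Upper S {x, y})" "x \<squnion>\<^bsub>S\<^esub> y = x \<squnion> y"
proof -
  have xy: "x \<in> carrier L" "y \<in> carrier L"
    using assms by (auto simp: dual_skeleton_def)
  have "z \<in> carrier L" if "z \<in> dual_skeleton L delta" for z
    using that by (simp add: dual_skeleton_def)
  then show "least S (x \<squnion> y) (Upper S {x, y})" "x \<squnion>\<^bsub>S\<^esub> y = x \<squnion> y"
    using assms(1,2) xy unfolding S_def
    by (auto intro!: partial_order.join_eqI[OF partial_order_dual_skeleton]
        simp: join_left join_right join_le join_mem_dual_skeleton)
qed

text \<open>De Morgan: on the skeleton \<open>delta\<close> is an order-reversing involution, so it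
  carries the join of \<open>delta x\<close> and \<open>delta y\<close> to the meet of x and
  y.\<close>

lemma dual_skeleton_meet_eq:
  assumes x: "x \<in> dual_skeleton L delta" and y: "y \<in> dual_skeleton L delta"
  defines "S \<equiv> L\<lparr>carrier := dual_skeleton L delta\<rparr>"
  shows "greatest S (dual_skeleton_meet L delta x y) (Lower S {x, y})"
    and "x \<sqinter>\<^bsub>S\<^esub> y = dual_skeleton_meet L delta x y"
proof -
  have xy: "x \<in> carrier L" "y \<in> carrier L" "delta (delta x) = x" "delta (delta y) = y"
    using assms by (auto simp: dual_skeleton_def)
  let ?m = "delta (delta x \<squnion> delta y)"
  have m: "?m \<in> dual_skeleton L delta"
    using xy by (simp add: delta_mem_dual_skeleton delta_closed)
  have "?m \<sqsubseteq> delta (delta x)" "?m \<sqsubseteq> delta (delta y)"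
    using xy(1,2) by (auto intro!: delta_antitone simp: delta_closed join_left join_right)
  then have le: "?m \<sqsubseteq> x" "?m \<sqsubseteq> y" by (simp_all add: xy)
  have great: "z \<sqsubseteq> ?m" if z: "z \<in> dual_skeleton L delta" "z \<sqsubseteq> x" "z \<sqsubseteq> y" for z
  proof -
    have z': "z \<in> carrier L" "delta (delta z) = z"
      using z by (auto simp: dual_skeleton_def)
    \<comment> \<open>A lower bound z becomes an upper bound \<open>delta z\<close>; a second
      \<open>delta\<close> turns the inequality back, because z is a fixed point.\<close>
    have "delta x \<squnion> delta y \<sqsubseteq> delta z"
      using z z'(1) xy by (auto intro!: join_le delta_antitone delta_closed)
    then have "delta (delta z) \<sqsubseteq> ?m"
      using z'(1) xy by (auto intro!: delta_antitone simp: delta_closed)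
    then show ?thesis by (simp add: z')
  qed
  show "greatest S (dual_skeleton_meet L delta x y) (Lower S {x, y})"
    and "x \<sqinter>\<^bsub>S\<^esub> y = dual_skeleton_meet L delta x y"
    using x y m le great unfolding S_def dual_skeleton_meet_def
    by (auto intro!: partial_order.meet_eqI[OF partial_order_dual_skeleton])
qed

lemma dual_skeleton_bottom:
  defines "S \<equiv> L\<lparr>carrier := dual_skeleton L delta\<rparr>"
  shows "least S \<bottom> (carrier S)" "\<bottom>\<^bsub>S\<^esub> = \<bottom>"
  unfolding S_def using bottom_mem_dual_skeleton
  by (intro partial_order.bottom_eqI[OF partial_order_dual_skeleton]; simp add: dual_skeleton_def)+

lemma dual_skeleton_top:
  defines "S \<equiv> L\<lparr>carrier := dual_skeleton L delta\<rparr>"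
  shows "greatest S \<top> (carrier S)" "\<top>\<^bsub>S\<^esub> = \<top>"
  unfolding S_def using top_mem_dual_skeleton
  by (intro partial_order.top_eqI[OF partial_order_dual_skeleton]; simp add: dual_skeleton_def)+

lemma ortholattice_dual_skeleton: "ortholattice (L\<lparr>carrier := dual_skeleton L delta\<rparr>) delta"
proof -
  let ?S = "L\<lparr>carrier := dual_skeleton L delta\<rparr>"
  interpret S: partial_order ?S by (rule partial_order_dual_skeleton)
  show ?thesis
  proof
    show "\<exists>s. least ?S s (Upper ?S {x, y})" "\<exists>s. greatest ?S s (Lower ?S {x, y})"
      if "x \<in> carrier ?S" "y \<in> carrier ?S" for x y
      using that dual_skeleton_join(1)[of x y] dual_skeleton_meet_eq(1)[of x y] by auto
    show "\<exists>x. least ?S x (carrier ?S)" "\<exists>x. greatest ?S x (carrier ?S)"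
      using dual_skeleton_bottom(1) dual_skeleton_top(1) by auto
    fix a assume "a \<in> carrier ?S"
    then have a: "a \<in> dual_skeleton L delta" "a \<in> carrier L" "delta (delta a) = a"
      by (auto simp: dual_skeleton_def)
    have da: "delta a \<in> dual_skeleton L delta"
      by (rule delta_mem_dual_skeleton) fact
    show "delta a \<in> carrier ?S" "delta (delta a) = a"
      using a da by simp_all
    show "a \<squnion>\<^bsub>?S\<^esub> delta a = \<top>\<^bsub>?S\<^esub>"
      using a da by (simp add: dual_skeleton_join dual_skeleton_top join_delta)
    \<comment> \<open>The skeleton meet unfolds to \<open>delta (delta a \<squnion> a)\<close>,
      which is \<open>delta \<top>\<close>, hence \<bottom>.\<close>
    show "a \<sqinter>\<^bsub>?S\<^esub> delta a = \<bottom>\<^bsub>?S\<^esub>"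
      using a da by (simp add: dual_skeleton_meet_eq dual_skeleton_bottom dual_skeleton_meet_def
          join_comm[of L "delta a"] join_delta delta_top)
    fix b assume "b \<in> carrier ?S" "a \<sqsubseteq>\<^bsub>?S\<^esub> b"
    then show "delta b \<sqsubseteq>\<^bsub>?S\<^esub> delta a"
      using a by (auto simp: dual_skeleton_def delta_antitone)
  qed
qed

section \<open>The filters [a)\<star> as a copy of the dual skeleton\<close>

lemma bounded_lattice_order_iso_dual_skeleton:
  "bounded_lattice_order_iso (L\<lparr>carrier := dual_skeleton L delta\<rparr>)
     (inclusion_order (star_principal_filters L delta)) (\<lambda>x. principal_filter L (delta x))"
proof -
  let ?S = "L\<lparr>carrier := dual_skeleton L delta\<rparr>"
  \<comment> \<open>Both \<open>delta\<close> and a \<mapsto> [a) reverse order, so their composite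
    preserves it.\<close>
  let ?f = "\<lambda>x. principal_filter L (delta x)"
  interpret S: ortholattice ?S delta by (rule ortholattice_dual_skeleton)
  interpret Lam: partial_order "inclusion_order (star_principal_filters L delta)"
    by (rule partial_order_inclusion_order)
  have S: "x \<in> carrier L" "delta (delta x) = x" if "x \<in> dual_skeleton L delta" for x
    using that by (auto simp: dual_skeleton_def)
  have "inj_on ?f (dual_skeleton L delta)"
    by (rule inj_onI) (metis S delta_closed inj_on_principal_filter inj_onD)
  moreover have "?f ` dual_skeleton L delta = star_principal_filters L delta"
  proof -
    \<comment> \<open>Replacing a by its double image leaves \<open>delta a\<close> unchanged, so
      the skeleton already produces every filter [a)\<star>.\<close>
    have "?f a = ?f (delta (delta a))" "delta (delta a) \<in> dual_skeleton L delta"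
      if "a \<in> carrier L" for a
      using that by (simp_all add: delta_delta_delta delta_mem_dual_skeleton delta_closed)
    then have "?f ` dual_skeleton L delta = ?f ` carrier L"
      using S(1) by blast
    then show ?thesis
      by (simp add: star_principal_filters_def principal_filter_delta)
  qed
  moreover have "?f x \<subseteq> ?f y \<longleftrightarrow> x \<sqsubseteq> y"
    if "x \<in> dual_skeleton L delta" "y \<in> dual_skeleton L delta" for x y
    \<comment> \<open>Inclusion says \<open>delta y\<close> \<sqsubseteq> \<open>delta x\<close>;
      one more \<open>delta\<close> recovers x \<sqsubseteq> y, since x and y are fixed
      points.\<close>
    using that S[of x] S[of y] delta_antitone[of "delta y" "delta x"]
    by (auto simp: principal_filter_subset_iff delta_closed delta_antitone)
  ultimately show ?thesis
    by unfold_locales (auto simp: bij_betw_def)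
qed

lemma ortholattice_iso_dual_skeleton:
  "ortholattice_iso (L\<lparr>carrier := dual_skeleton L delta\<rparr>) delta
     (inclusion_order (star_principal_filters L delta)) (filter_star L delta)
     (\<lambda>x. principal_filter L (delta x))"
  by (rule bounded_lattice_order_iso.ortholattice_iso_image
      [OF bounded_lattice_order_iso_dual_skeleton ortholattice_dual_skeleton])
    (simp add: dual_skeleton_def principal_filter_delta[symmetric] delta_closed)

text \<open>The meet in \<Lambda>(L) is the image of the skeleton meet. Its \<open>delta\<close> is
  the double image of \<open>delta x \<squnion> delta y\<close>, which is fixed because the skeleton
  is closed under joins, and the filter of a join is an intersection.\<close>

lemma star_principal_filters_meet:
  assumes "F \<in> star_principal_filters L delta" "G \<in> star_principal_filters L delta"
  shows "F \<sqinter>\<^bsub>inclusion_order (star_principal_filters L delta)\<^esub> G = F \<inter> G"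
proof -
  let ?S = "L\<lparr>carrier := dual_skeleton L delta\<rparr>"
  interpret iso: bounded_lattice_order_iso ?S
    "inclusion_order (star_principal_filters L delta)" "\<lambda>x. principal_filter L (delta x)"
    by (rule bounded_lattice_order_iso_dual_skeleton)
  obtain x where x: "x \<in> dual_skeleton L delta" "F = principal_filter L (delta x)"
    by (rule iso.preimage[of F]) (use assms(1) in auto)
  obtain y where y: "y \<in> dual_skeleton L delta" "G = principal_filter L (delta y)"
    by (rule iso.preimage[of G]) (use assms(2) in auto)
  have xy: "x \<in> carrier L" "y \<in> carrier L"
    using x y by (auto simp: dual_skeleton_def)
  have "delta x \<squnion> delta y \<in> dual_skeleton L delta"
    using xy by (intro join_mem_dual_skeleton delta_mem_dual_skeleton)
  then have "delta (delta (delta x \<squnion> delta y)) = delta x \<squnion> delta y"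
    by (simp add: dual_skeleton_def)
  then have "delta (x \<sqinter>\<^bsub>?S\<^esub> y) = delta x \<squnion> delta y"
    using x y by (simp add: dual_skeleton_meet_eq dual_skeleton_meet_def)
  then show ?thesis
    using x y xy iso.meet_image(2)[of x y] by (simp add: principal_filter_join delta_closed)
qed

end

theorem theorem3p8:
  fixes L :: "('a, 'b) gorder_scheme" and delta nabla :: "'a \<Rightarrow> 'a"
  assumes "weakly_dicomplemented_lattice L delta nabla"
  defines "Fp \<equiv> inclusion_order (principal_filters L)"
    and "Lam \<equiv> inclusion_order (star_principal_filters L delta)"
    and "S \<equiv> L\<lparr>carrier := dual_skeleton L delta\<rparr>"
    and "star \<equiv> filter_star L delta"
  shows
    "(dual_weakly_complemented_lattice Fp star \<and>
      (\<forall>F\<in>carrier Fp. \<forall>G\<in>carrier Fp. F \<sqinter>\<^bsub>Fp\<^esub> G = F \<inter> G) \<and>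
      (\<forall>F\<in>carrier Fp. \<forall>G\<in>carrier Fp. F \<squnion>\<^bsub>Fp\<^esub> G = filter_join L F G) \<and>
      \<bottom>\<^bsub>Fp\<^esub> = {\<top>\<^bsub>L\<^esub>} \<and> \<top>\<^bsub>Fp\<^esub> = carrier L \<and>
      weakly_complemented_lattice L delta \<and>
      bij_betw (principal_filter L) (carrier L) (carrier Fp) \<and>
      (\<forall>a\<in>carrier L. \<forall>b\<in>carrier L.
        principal_filter L (a \<squnion>\<^bsub>L\<^esub> b) = principal_filter L a \<inter> principal_filter L b) \<and>
      (\<forall>a\<in>carrier L. \<forall>b\<in>carrier L.
        principal_filter L (a \<sqinter>\<^bsub>L\<^esub> b) =
          filter_join L (principal_filter L a) (principal_filter L b)) \<and>
      (\<forall>a\<in>carrier L. principal_filter L (delta a) = star (principal_filter L a)) \<and>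
      principal_filter L \<bottom>\<^bsub>L\<^esub> = carrier L \<and> principal_filter L \<top>\<^bsub>L\<^esub> = {\<top>\<^bsub>L\<^esub>})
     \<and>
     (ortholattice Lam star \<and>
      (\<forall>F\<in>carrier Lam. \<forall>G\<in>carrier Lam. F \<sqinter>\<^bsub>Lam\<^esub> G = F \<inter> G) \<and>
      \<bottom>\<^bsub>Lam\<^esub> = {\<top>\<^bsub>L\<^esub>} \<and> \<top>\<^bsub>Lam\<^esub> = carrier L \<and>
      ortholattice S delta \<and>
      (\<forall>x\<in>carrier S. \<forall>y\<in>carrier S. x \<sqinter>\<^bsub>S\<^esub> y = dual_skeleton_meet L delta x y) \<and>
      (\<forall>x\<in>carrier S. \<forall>y\<in>carrier S. x \<squnion>\<^bsub>S\<^esub> y = x \<squnion>\<^bsub>L\<^esub> y) \<and>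
      \<bottom>\<^bsub>S\<^esub> = \<bottom>\<^bsub>L\<^esub> \<and> \<top>\<^bsub>S\<^esub> = \<top>\<^bsub>L\<^esub> \<and>
      (\<exists>f. ortholattice_iso Lam star S delta f))"
proof -
  interpret weakly_dicomplemented_lattice L delta nabla by fact
  interpret Fp: bounded_lattice_order_iso "inv_gorder L" Fp "principal_filter L"
    unfolding Fp_def by (rule bounded_lattice_order_iso_principal_filter)
  interpret Lam: bounded_lattice_order_iso S Lam "\<lambda>x. principal_filter L (delta x)"
    unfolding S_def Lam_def by (rule bounded_lattice_order_iso_dual_skeleton)
  have iso: "ortholattice_iso S delta Lam star (\<lambda>x. principal_filter L (delta x))"
    unfolding S_def Lam_def star_def by (rule ortholattice_iso_dual_skeleton)
  have "F \<sqinter>\<^bsub>Fp\<^esub> G = F \<inter> G" "F \<squnion>\<^bsub>Fp\<^esub> G = filter_join L F G"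
    if FG: "F \<in> carrier Fp" "G \<in> carrier Fp" for F G
  proof -
    obtain a b where "a \<in> carrier L" "F = principal_filter L a"
      and "b \<in> carrier L" "G = principal_filter L b"
      \<comment> \<open>Writing both filters as principal ones reduces the two identities to the
        formulas for [a \<squnion> b) and [a \<sqinter> b).\<close>
      using FG by (auto elim!: Fp.preimage)
    then show "F \<sqinter>\<^bsub>Fp\<^esub> G = F \<inter> G" "F \<squnion>\<^bsub>Fp\<^esub> G = filter_join L F G"
      using Fp.meet_image(2)[of a b] Fp.join_image(2)[of a b]
      by (simp_all add: principal_filter_join principal_filter_meet)
  qed
  moreover have "\<bottom>\<^bsub>Fp\<^esub> = {\<top>\<^bsub>L\<^esub>}" "\<top>\<^bsub>Fp\<^esub> = carrier L"
    using Fp.bottom_image(2) Fp.top_image(2)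
    by (simp_all add: principal_filter_top principal_filter_bottom)
  moreover have "bij_betw (principal_filter L) (carrier L) (carrier Fp)"
    using Fp.bij by simp
  moreover have "dual_weakly_complemented_lattice Fp star"
    unfolding Fp_def star_def by (rule dual_weakly_complemented_lattice_principal_filters)
  \<comment> \<open>The bounds keep their places under x \<mapsto> [\<open>delta x\<close>):
    \<bottom> goes to [\<top>) and \<top> goes to [\<bottom>).\<close>
  moreover have "\<bottom>\<^bsub>Lam\<^esub> = {\<top>\<^bsub>L\<^esub>}" "\<top>\<^bsub>Lam\<^esub> = carrier L"
    using Lam.bottom_image(2) Lam.top_image(2)
    by (simp_all add: S_def dual_skeleton_bottom dual_skeleton_top delta_bottom delta_top
        principal_filter_top principal_filter_bottom)
  moreover have "F \<sqinter>\<^bsub>Lam\<^esub> G = F \<inter> G" if "F \<in> carrier Lam" "G \<in> carrier Lam" for F G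
    using that by (simp add: Lam_def star_principal_filters_meet)
  moreover have "x \<sqinter>\<^bsub>S\<^esub> y = dual_skeleton_meet L delta x y" "x \<squnion>\<^bsub>S\<^esub> y = x \<squnion>\<^bsub>L\<^esub> y"
    if "x \<in> carrier S" "y \<in> carrier S" for x y
    using that by (simp_all add: S_def dual_skeleton_join dual_skeleton_meet_eq)
  moreover have "\<bottom>\<^bsub>S\<^esub> = \<bottom>\<^bsub>L\<^esub>" "\<top>\<^bsub>S\<^esub> = \<top>\<^bsub>L\<^esub>"
    by (simp_all add: S_def dual_skeleton_bottom dual_skeleton_top)
  moreover have "ortholattice S delta" "ortholattice Lam star"
    using iso by (simp_all add: ortholattice_iso_def)
  moreover have "\<exists>f. ortholattice_iso Lam star S delta f"
    using ortholattice_iso_sym[OF iso] by blast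
  moreover note weakly_complemented_lattice_axioms
  ultimately show ?thesis
    by (simp add: principal_filter_join principal_filter_meet principal_filter_delta
        principal_filter_bottom principal_filter_top star_def)
qed

end
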